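(* Let $n\ge 1$ and $\mathbf{d}=(1,1,\ldots,1)$ ($n$ entries, i.e. $s=n$ and $d_1=\cdots=d_n=1$). Then $$ \mathcal{PI}_{\mathbf{d}}(z)=\sum_{k=1}^n \frac{(-1)^{n-k}}{(k-1)!}\,\frac{(n)_{n-k}}{(n-k)!}\,\frac{d^{k-1}}{dz^{k-1}}\left(\left(\frac{z}{1-z^2}\right)^{2n-k-1}\right), $$ $$ \mathcal{PS}_{\mathbf{d}}(z)=\sum_{k=1}^n \frac{(-1)^{n-k}}{(k-1)!}\,\frac{(n)_{n-k}}{(n-k)!}\,\frac{d^{k-1}}{dz^{k-1}}\left(\frac{(1+z)z^{2n-k-1}}{(1-z^2)^{2n-k}}\right), $$ where $(n)_m:=n(n+1)\cdots(n+m-1)$, $(n)_0:=1$.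
   Context: Let $\mathbb{K}$ be a field of characteristic $0$. For a tuple $\mathbf{d}=(d_1,\ldots,d_s)$ of nonnegative integers let $\mathbb{K}[X_{\mathbf{d}}]$ be the polynomial algebra in the variables $x_i^{(k)}$, $1\le k\le s$, $0\le i\le d_k$. Define $\mathbb{K}$-linear derivations of $\mathbb{K}[X_{\mathbf{d}}]$ by $$\mathcal{D}_{\mathbf{d}}(x_i^{(k)})=i\,x_{i-1}^{(k)},\qquad \mathcal{D}^*_{\mathbf{d}}(x_i^{(k)})=(d_k-i)\,x_{i+1}^{(k)}$$ (with $\mathcal{D}_{\mathbf{d}}(x_0^{(k)})=0$ and $\mathcal{D}^*_{\mathbf{d}}(x_{d_k}^{(k)})=0$). Put $\mathcal{I}_{\mathbf{d}}=\{v : \mathcal{D}_{\mathbf{d}}(v)=\mathcal{D}^*_{\mathbf{d}}(v)=0\}$ and $\mathcal{S}_{\mathbf{d}}=\ker\mathcal{D}_{\mathbf{d}}=\{v : \mathcal{D}_{\mathbf{d}}(v)=0\}$, graded by total degree, with homogeneous components $(\cdot)_m$. Their Poincaré series are $$\mathcal{PI}_{\mathbf{d}}(z)=\sum_{m\ge0}\dim(\mathcal{I}_{\mathbf{d}})_m z^m,\qquad \mathcal{PS}_{\mathbf{d}}(z)=\sum_{m\ge0}\dim(\mathcal{S}_{\mathbf{d}})_m z^m.$$ Rational functions are identified with their power series expansions at $z=0$. *)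

theory Defs
  imports
    "HOL-Library.Poly_Mapping"
    "HOL-Computational_Algebra.Formal_Power_Series"
begin

(* The pair (k, i) names the variable x_i^(k).  Upper indices are 0-based, i.e. k < length d,
   so that the entry d_k of the tuple is the list element d ! k.
   A monomial is its exponent vector; a polynomial maps monomials to coefficients. *)
type_synonym monom = "(nat \<times> nat) \<Rightarrow>\<^sub>0 nat"
type_synonym 'k mpoly = "monom \<Rightarrow>\<^sub>0 'k"

abbreviation Var :: "nat \<Rightarrow> nat \<Rightarrow> 'k::field mpoly" where
  "Var k i \<equiv> Poly_Mapping.single (Poly_Mapping.single (k, i) 1) 1"

definition scale :: "'k::field \<Rightarrow> 'k mpoly \<Rightarrow> 'k mpoly" where
  "scale c p = Poly_Mapping.single 0 c * p"

global_interpretation mpoly: vector_space "scale :: 'k::field \<Rightarrow> 'k mpoly \<Rightarrow> 'k mpoly"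
  by unfold_locales (simp_all add: scale_def algebra_simps single_add mult_single flip: mult.assoc)

definition vars :: "nat list \<Rightarrow> (nat \<times> nat) set" where
  "vars d = {(k, i). k < length d \<and> i \<le> d ! k}"

definition polys :: "nat list \<Rightarrow> 'k::field mpoly set" where
  "polys d = {p. \<forall>m\<in>Poly_Mapping.keys p. Poly_Mapping.keys m \<subseteq> vars d}"

definition total_degree :: "monom \<Rightarrow> nat" where
  "total_degree m = (\<Sum>v\<in>Poly_Mapping.keys m. Poly_Mapping.lookup m v)"

definition homogeneous :: "nat \<Rightarrow> 'k::field mpoly set" where
  "homogeneous n = {p. \<forall>m\<in>Poly_Mapping.keys p. total_degree m = n}"

(* The linear derivation with x_v |-> g v, given explicitly as the sum over v of
   (dp/dx_v) * g v.  The lemmas below show that it is the unique such derivation. *)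
definition derivation :: "(nat \<times> nat \<Rightarrow> 'k mpoly) \<Rightarrow> 'k::field mpoly \<Rightarrow> 'k mpoly" where
  "derivation g p = (\<Sum>m\<in>Poly_Mapping.keys p. \<Sum>v\<in>Poly_Mapping.keys m.
     Poly_Mapping.single (m - Poly_Mapping.single v 1)
       (Poly_Mapping.lookup p m * of_nat (Poly_Mapping.lookup m v)) * g v)"

(* The boundary cases i = 0 and i = d_k yield 0 because the integer factor vanishes.
   Both operators are defined on all variables; only their restriction to polys d matters. *)
definition Dop :: "'k::field mpoly \<Rightarrow> 'k mpoly" where
  "Dop = derivation (\<lambda>(k, i). scale (of_nat i) (Var k (i - 1)))"

definition Dstar_op :: "nat list \<Rightarrow> 'k::field mpoly \<Rightarrow> 'k mpoly" where
  "Dstar_op d = derivation (\<lambda>(k, i). scale (of_nat (d ! k - i)) (Var k (i + 1)))"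

definition invariants :: "nat list \<Rightarrow> 'k::field mpoly set" where
  "invariants d = {p \<in> polys d. Dop p = 0 \<and> Dstar_op d p = 0}"

definition semi_invariants :: "nat list \<Rightarrow> 'k::field mpoly set" where
  "semi_invariants d = {p \<in> polys d. Dop p = 0}"

(* The type argument supplies the ground field K. *)
definition PI :: "'k::field itself \<Rightarrow> nat list \<Rightarrow> rat fps" where
  "PI _ d = Abs_fps (\<lambda>n. of_nat (mpoly.dim ((invariants d :: 'k mpoly set) \<inter> homogeneous n)))"

definition PS :: "'k::field itself \<Rightarrow> nat list \<Rightarrow> rat fps" where
  "PS _ d = Abs_fps (\<lambda>n. of_nat (mpoly.dim ((semi_invariants d :: 'k mpoly set) \<inter> homogeneous n)))"

lemma derivation_add: "derivation g (p + q) = derivation g p + derivation g q"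
  unfolding derivation_def
  by (rule setsum_keys_plus_distrib) (simp_all add: algebra_simps single_add sum.distrib)

lemma derivation_single:
  "derivation g (Poly_Mapping.single m c) =
     (\<Sum>v\<in>Poly_Mapping.keys m. Poly_Mapping.single (m - Poly_Mapping.single v 1) (c * of_nat (Poly_Mapping.lookup m v)) * g v)"
  by (cases "c = 0") (simp_all add: derivation_def)

lemma derivation_single_superset:
  assumes "finite A" "Poly_Mapping.keys m \<subseteq> A"
  shows "derivation g (Poly_Mapping.single m c) =
     (\<Sum>v\<in>A. Poly_Mapping.single (m - Poly_Mapping.single v 1) (c * of_nat (Poly_Mapping.lookup m v)) * g v)"
  unfolding derivation_single
  by (rule sum.mono_neutral_left) (use assms in \<open>auto simp: in_keys_iff\<close>)

lemma derivation_Var: "derivation g (Var k i) = g (k, i)"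
  by (simp add: derivation_single)

lemma monom_shift:
  assumes "Poly_Mapping.lookup (m :: monom) v \<noteq> 0"
  shows "m - Poly_Mapping.single v 1 + n = m + n - Poly_Mapping.single v 1"
  using assms by (intro poly_mapping_eqI) (auto simp: lookup_add lookup_minus lookup_single when_def)

lemma derivation_mult_single:
  fixes a b :: "'k::field"
  shows "derivation g (Poly_Mapping.single m a * Poly_Mapping.single n b) =
     derivation g (Poly_Mapping.single m a) * Poly_Mapping.single n b +
     Poly_Mapping.single m a * derivation g (Poly_Mapping.single n b)"
proof -
  let ?A = "Poly_Mapping.keys m \<union> Poly_Mapping.keys n" and ?s = "\<lambda>v. Poly_Mapping.single v (1 :: nat)"
  have 1: "Poly_Mapping.single (m + n - ?s v) (a * b * of_nat (Poly_Mapping.lookup (m + n) v)) * g v =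
      Poly_Mapping.single (m - ?s v) (a * of_nat (Poly_Mapping.lookup m v)) * g v * Poly_Mapping.single n b +
      Poly_Mapping.single m a * (Poly_Mapping.single (n - ?s v) (b * of_nat (Poly_Mapping.lookup n v)) * g v)"
    for v
  proof -
    have A: "Poly_Mapping.single (m - ?s v) (a * of_nat (Poly_Mapping.lookup m v)) * Poly_Mapping.single n b =
        Poly_Mapping.single (m + n - ?s v) (a * b * of_nat (Poly_Mapping.lookup m v))"
      using monom_shift[of m v n]
      by (cases "Poly_Mapping.lookup m v = 0") (simp_all add: mult_single mult.assoc mult.commute[of _ b])
    have B: "Poly_Mapping.single m a * Poly_Mapping.single (n - ?s v) (b * of_nat (Poly_Mapping.lookup n v)) =
        Poly_Mapping.single (m + n - ?s v) (a * b * of_nat (Poly_Mapping.lookup n v))"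
      using monom_shift[of n v m]
      by (cases "Poly_Mapping.lookup n v = 0") (simp_all add: mult_single mult.assoc add.commute)
    have *: "x * h * y + z * (w * h) = (x * y + z * w) * h" for x y z w h :: "'k mpoly"
      by (simp add: algebra_simps)
    show ?thesis
      unfolding * A B by (simp only: lookup_add of_nat_add distrib_left single_add)
  qed
  have "Poly_Mapping.keys (m + n) \<subseteq> ?A" by (rule keys_add)
  then show ?thesis
    by (simp only: mult_single derivation_single_superset[of ?A] 1 sum.distrib sum_distrib_left
        sum_distrib_right finite_Un finite_keys Un_upper1 Un_upper2)
qed

lemma mpoly_induct [case_names zero add]:
  fixes p :: "'k::field mpoly"
  assumes "P 0" "\<And>m c p. P p \<Longrightarrow> P (Poly_Mapping.single m c + p)"
  shows "P p"
proof -
  have sum: "P (\<Sum>m\<in>A. Poly_Mapping.single m (Poly_Mapping.lookup p m))" if "finite A" for A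
    using that by induction (use assms in auto)
  have p: "p = (\<Sum>m\<in>Poly_Mapping.keys p. Poly_Mapping.single m (Poly_Mapping.lookup p m))"
    by (rule poly_mapping_eqI)
       (simp add: lookup_sum lookup_single when_def in_keys_iff sum.delta)
  show ?thesis
    by (subst p) (rule sum[OF finite_keys])
qed

lemma derivation_zero [simp]: "derivation g 0 = 0"
  by (simp add: derivation_def)

lemma derivation_mult: "derivation g (p * q) = derivation g p * q + p * derivation g q"
proof (induction p rule: mpoly_induct)
  case (add m c p)
  have "derivation g (Poly_Mapping.single m c * q) =
      derivation g (Poly_Mapping.single m c) * q + Poly_Mapping.single m c * derivation g q"
    by (induction q rule: mpoly_induct)
       (simp_all add: derivation_add derivation_mult_single distrib_left add_ac)
  with add show ?case by (simp add: derivation_add distrib_right distrib_left add_ac)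
qed simp

lemma derivation_scale: "derivation g (scale c p) = scale c (derivation g p)"
  by (simp add: scale_def derivation_mult derivation_single)

lemma derivation_unique:
  fixes E :: "'k::field mpoly \<Rightarrow> 'k mpoly"
  assumes add: "\<And>p q. E (p + q) = E p + E q"
    and scale: "\<And>c p. E (scale c p) = scale c (E p)"
    and mult: "\<And>p q. E (p * q) = E p * q + p * E q"
    and Var: "\<And>k i. E (Var k i) = g (k, i)"
  shows "E p = derivation g p"
proof -
  have zero: "E 0 = 0" using add[of 0 0] by simp
  have one: "E 1 = 0" using mult[of 1 1] by simp
  have mono: "E (Poly_Mapping.single m 1) = derivation g (Poly_Mapping.single m 1)" for m
  proof (induction "total_degree m" arbitrary: m)
    case 0
    then have "m = 0"
      by (intro poly_mapping_eqI) (auto simp: total_degree_def in_keys_iff)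
    then show ?case using derivation_single[of g 0 1] by (simp add: one)
  next
    case (Suc n)
    then have "Poly_Mapping.keys m \<noteq> {}" by (auto simp: total_degree_def)
    then obtain k i where v: "(k, i) \<in> Poly_Mapping.keys m"
      by (metis ex_in_conv surj_pair)
    define m' where "m' = m - Poly_Mapping.single (k, i) 1"
    have m: "m = Poly_Mapping.single (k, i) 1 + m'"
      unfolding m'_def using v
      by (intro poly_mapping_eqI) (auto simp: in_keys_iff lookup_add lookup_minus lookup_single when_def)
    have deg: "total_degree l = (\<Sum>v\<in>Poly_Mapping.keys m. Poly_Mapping.lookup l v)"
      if "Poly_Mapping.keys l \<subseteq> Poly_Mapping.keys m" for l
      unfolding total_degree_def
      by (rule sum.mono_neutral_left) (use that in \<open>auto simp: in_keys_iff\<close>)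
    have "Poly_Mapping.keys m' \<subseteq> Poly_Mapping.keys m" by (auto simp: m'_def in_keys_iff lookup_minus)
    then have "total_degree m = Suc (total_degree m')"
      using v by (subst (1 2) deg) (auto simp: m lookup_add sum.distrib lookup_single when_def)
    with Suc have IH: "E (Poly_Mapping.single m' 1) = derivation g (Poly_Mapping.single m' 1)"
      by simp
    have split: "Poly_Mapping.single m (1 :: 'k) = Var k i * Poly_Mapping.single m' 1"
      by (simp add: mult_single m)
    show ?case unfolding split by (simp only: mult derivation_mult IH Var derivation_Var)
  qed
  have single: "E (Poly_Mapping.single m c) = derivation g (Poly_Mapping.single m c)" for m c
  proof -
    have *: "Poly_Mapping.single m c = scale c (Poly_Mapping.single m 1)"
      by (simp add: scale_def mult_single)
    show ?thesis
      by (subst (1 2) *) (simp only: scale derivation_scale mono)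
  qed
  show ?thesis
    by (induction p rule: mpoly_induct) (simp_all only: zero derivation_zero add derivation_add single)
qed

end

theory Submission
  imports Defs
begin

text \<open>For linear forms, \<open>\<D>\<close> and \<open>\<D>\<^sup>*\<close> are the raising and lowering operators of an \<open>sl\<^sub>2\<close>-action
  on polynomials, where a monomial of degree \<open>a\<close> in the \<open>x\<^sub>0\<close> and degree \<open>b\<close> in the \<open>x\<^sub>1\<close> has weight
  \<open>a - b\<close>; there are \<open>h\<^sub>a h\<^sub>b\<close> such monomials, with \<open>h\<^sub>a\<close> the binomial coefficient of \<open>n + a - 1\<close> over \<open>a\<close>.
  As \<open>\<D>\<close> is injective on negative weights and maps onto positive weights, invariants live in weight 0,
  semi-invariants in weights \<open>\<ge> 0\<close>, and rank-nullity gives their dimensions in degree \<open>m\<close>.  With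
  \<open>G\<^sub>c = (\<Sum>a. h\<^sub>a h\<^sub>a\<^sub>+\<^sub>c z\<^sup>2\<^sup>a\<^sup>+\<^sup>c)\<close>, which counts the monomials of weight \<open>c\<close>, the series are \<open>G\<^sub>0 - G\<^sub>2\<close> and \<open>G\<^sub>0 + G\<^sub>1\<close>.
  Each \<open>G\<^sub>c\<close> is itself a sum of derivatives as in the theorem: comparing coefficients,
  this is Vandermonde's identity.\<close>

unbundle fps_syntax

section \<open>Rank and nullity\<close>

text \<open>The coordinates of \<open>x\<close> over \<open>B \<union> C\<close> agree with those
  over \<open>B\<close> and with those over \<open>C\<close>, so they are supported in
  \<open>B \<inter> C\<close> and all vanish.\<close>

lemma (in vector_space) span_Int_span_disjoint:
  assumes "independent (B \<union> C)" "B \<inter> C = {}" "x \<in> span B" "x \<in> span C"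
  shows "x = 0"
proof -
  have B: "representation (B \<union> C) x = representation B x"
    using assms by (intro representation_extend) auto
  have C: "representation (B \<union> C) x = representation C x"
    using assms by (intro representation_extend) auto
  have "representation B x b = 0" for b
    using representation_ne_zero[of B x b] representation_ne_zero[of C x b] B C assms(2) by auto
  moreover have "(\<Sum>b | representation B x b \<noteq> 0. scale (representation B x b) b) = x"
    using independent_mono[OF assms(1), of B] assms(3) by (intro sum_nonzero_representation_eq) auto
  ultimately show ?thesis by simp
qed

text \<open>A basis \<open>B\<close> of the kernel extends to a basis \<open>C\<close> of
  \<open>V\<close>, and \<open>f\<close> carries \<open>C - B\<close> injectively to a basis of the
  image. The finite set \<open>A\<close> makes \<open>C\<close> finite, so that cardinalities can be
  subtracted.\<close>

lemma (in Vector_Spaces.linear) dim_kernel_plus_dim_image: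
  assumes V: "vs1.subspace V" and fin: "finite A" "V \<subseteq> vs1.span A"
  shows "vs1.dim {v \<in> V. f v = 0} + vs2.dim (f ` V) = vs1.dim V"
proof -
  let ?K = "{v \<in> V. f v = 0}"
  obtain B where B: "B \<subseteq> ?K" "vs1.independent B" "?K \<subseteq> vs1.span B"
    by (rule vs1.maximal_independent_subset)
  obtain C where C: "B \<subseteq> C" "C \<subseteq> V" "vs1.independent C" "V \<subseteq> vs1.span C"
    using vs1.maximal_independent_subset_extend[of B V] B by auto
  have "finite C"
    using vs1.independent_span_bound[OF fin(1) C(3)] C(2) fin(2) by auto
  have inj: "inj_on f (vs1.span (C - B))"
  proof (subst inj_on_iff_eq_0)
    show "\<forall>x\<in>vs1.span (C - B). f x = 0 \<longrightarrow> x = 0"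
    proof (intro ballI impI)
      fix x assume x: "x \<in> vs1.span (C - B)" "f x = 0"
      have "x \<in> V"
        using vs1.span_minimal[of "C - B" V] C(2) V x(1) by blast
      then show "x = 0"
        using x B(3) C vs1.span_Int_span_disjoint[of B "C - B" x] by (auto simp: Un_absorb1)
    qed
  qed (rule vs1.subspace_span)
  have f0: "f b = 0" if "b \<in> B" for b using that B by auto
  have "f ` V \<subseteq> vs2.span (f ` (C - B))"
  proof -
    have "f ` V \<subseteq> vs2.span (f ` C)" using C(4) by (auto simp: span_image)
    also have "f ` C \<subseteq> insert 0 (f ` (C - B))" using f0 by auto
    then have "vs2.span (f ` C) \<subseteq> vs2.span (f ` (C - B))"
      by (metis vs2.span_insert_0 vs2.span_mono)
    finally show ?thesis .
  qed
  moreover have "vs2.independent (f ` (C - B))"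
    using vs1.independent_mono[OF C(3), of "C - B"] inj by (intro independent_injective_image) auto
  ultimately have "vs2.dim (f ` V) = card (f ` (C - B))"
    using C(2) by (intro vs2.dim_unique) auto
  also have "\<dots> = card (C - B)"
    by (intro card_image inj_on_subset[OF inj]) (rule vs1.span_superset)
  also have "\<dots> = card C - card B"
    using C(1) \<open>finite C\<close> by (intro card_Diff_subset) (auto intro: finite_subset)
  finally show ?thesis
    using vs1.basis_card_eq_dim[OF B(1,3,2)] vs1.basis_card_eq_dim[OF C(2,4,3)]
      card_mono[OF \<open>finite C\<close> C(1)] by simp
qed

section \<open>Representations of \<open>sl\<^sub>2\<close>\<close>

text \<open>The weight spaces \<open>W w\<close> replace the operator H = [E, F], which acts on them
  as the scalar \<open>w\<close>. Bounded weights take the place of finite dimension: some power of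
  \<open>E\<close> and of \<open>F\<close> kills each weight vector.\<close>

locale sl2_rep = vector_space scale
  for scale :: "'a::field_char_0 \<Rightarrow> 'b::ab_group_add \<Rightarrow> 'b" (infixr \<open>*s\<close> 75) +
  fixes E F :: "'b \<Rightarrow> 'b" and W :: "int \<Rightarrow> 'b set" and N :: int
  assumes E_add: "E (x + y) = E x + E y" and E_scale: "E (c *s x) = c *s E x"
    and F_add: "F (x + y) = F x + F y" and F_scale: "F (c *s x) = c *s F x"
    and W_subspace: "subspace (W w)"
    and E_W: "x \<in> W w \<Longrightarrow> E x \<in> W (w + 2)"
    and F_W: "x \<in> W w \<Longrightarrow> F x \<in> W (w - 2)"
    and commutator: "x \<in> W w \<Longrightarrow> E (F x) - F (E x) = of_int w *s x"
    and W_bounded: "\<bar>w\<bar> > N \<Longrightarrow> W w \<subseteq> {0}"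
begin

lemma E_0 [simp]: "E 0 = 0" and F_0 [simp]: "F 0 = 0"
  using E_scale[of 0 0] F_scale[of 0 0] by simp_all

lemma E_pow_add: "(E ^^ j) (x + y) = (E ^^ j) x + (E ^^ j) y"
  by (induction j) (auto simp: E_add)

lemma E_pow_scale: "(E ^^ j) (c *s x) = c *s (E ^^ j) x"
  by (induction j) (auto simp: E_scale)

lemma E_pow_W: "x \<in> W w \<Longrightarrow> (E ^^ j) x \<in> W (w + 2 * int j)"
proof (induction j)
  case (Suc j)
  then show ?case using E_W[of "(E ^^ j) x" "w + 2 * int j"] by (simp add: algebra_simps)
qed simp

lemma F_pow_W: "x \<in> W w \<Longrightarrow> (F ^^ j) x \<in> W (w - 2 * int j)"
proof (induction j)
  case (Suc j)
  then show ?case using F_W[of "(F ^^ j) x" "w - 2 * int j"] by (simp add: algebra_simps)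
qed simp

text \<open>Moving \<open>E\<close> past one more \<open>F\<close> adds the weight
  \<open>w - 2 * (j + 1)\<close> of \<open>(F ^^ Suc j) x\<close> to the scalar. These weights sum
  to the stated product.\<close>

lemma E_F_pow:
  assumes "x \<in> W w" "E x = 0"
  shows "E ((F ^^ Suc j) x) = of_int (int (Suc j) * (w - int j)) *s (F ^^ j) x"
proof (induction j)
  case 0
  then show ?case using commutator[OF assms(1)] assms(2) by simp
next
  case (Suc j)
  let ?y = "(F ^^ Suc j) x"
  have "E (F ?y) = of_int (w - 2 * int (Suc j)) *s ?y + F (E ?y)"
    using commutator[OF F_pow_W[OF assms(1)], of "Suc j"] by (simp add: algebra_simps)
  also have "F (E ?y) = of_int (int (Suc j) * (w - int j)) *s ?y"
    unfolding Suc.IH by (simp add: F_scale)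
  finally have "E (F ?y) =
      of_int (w - 2 * int (Suc j) + int (Suc j) * (w - int j)) *s ?y"
    by (simp only: scale_left_distrib of_int_add)
  also have "w - 2 * int (Suc j) + int (Suc j) * (w - int j) = int (Suc (Suc j)) * (w - int (Suc j))"
    by (simp add: algebra_simps)
  finally show ?case by simp
qed

text \<open>For negative \<open>w\<close> the scalars of \<open>E_F_pow\<close> never vanish, so
  \<open>(F ^^ Suc j) x = 0\<close> forces \<open>(F ^^ j) x = 0\<close>. Since a high power of
  \<open>F\<close> kills \<open>x\<close>, descent reaches \<open>x = 0\<close>.\<close>

lemma E_inj:
  assumes "x \<in> W w" "E x = 0" "w < 0"
  shows "x = 0"
proof -
  have step: "(F ^^ j) x = 0" if "(F ^^ Suc j) x = 0" for j
  proof -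
    have "of_int (int (Suc j) * (w - int j)) *s (F ^^ j) x = 0"
      using E_F_pow[OF assms(1,2), of j] that by simp
    moreover have "int (Suc j) * (w - int j) \<noteq> 0" using assms(3) by simp
    ultimately show ?thesis by (metis scale_eq_0_iff of_int_eq_0_iff)
  qed
  have "(F ^^ j) x = 0 \<Longrightarrow> x = 0" for j
    by (induction j) (use step in auto)
  \<comment> \<open>Large enough that lowering the weight \<open>M\<close> times leaves the range of
    admissible weights.\<close>
  moreover define M where "M = Suc (nat \<bar>N\<bar>)"
  have "W (w - 2 * int M) \<subseteq> {0}"
    by (rule W_bounded) (use assms(3) in \<open>auto simp: M_def\<close>)
  then have "(F ^^ M) x = 0"
    using F_pow_W[OF assms(1), of M] by blast
  ultimately show ?thesis by blast
qed

text \<open>The scalar is the product of the factors (i + 1)(w - i) of \<open>E_F_pow\<close> over i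
  < j, all nonzero because \<open>w\<close> is at least \<open>j\<close>.\<close>

lemma E_pow_F_pow:
  assumes "x \<in> W w" "E x = 0" "w \<ge> int j"
  shows "\<exists>c. c \<noteq> 0 \<and> (E ^^ j) ((F ^^ j) x) = c *s x"
  using assms(3)
proof (induction j)
  case 0
  show ?case by (intro exI[of _ 1]) simp
next
  case (Suc j)
  then obtain c where c: "c \<noteq> 0" "(E ^^ j) ((F ^^ j) x) = c *s x" by auto
  let ?k = "of_int (int (Suc j) * (w - int j)) :: 'a"
  have "(E ^^ Suc j) ((F ^^ Suc j) x) = (E ^^ j) (E ((F ^^ Suc j) x))"
    by (simp add: funpow_swap1)
  also have "\<dots> = (?k * c) *s x"
    unfolding E_F_pow[OF assms(1,2)] E_pow_scale c(2) by simp
  finally have "(E ^^ Suc j) ((F ^^ Suc j) x) = (?k * c) *s x" .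
  moreover have "?k \<noteq> 0"
    unfolding of_int_eq_0_iff using Suc.prems by simp
  ultimately show ?case
    using c(1) by (metis mult_eq_0_iff)
qed

text \<open>Induction on the nilpotency order of \<open>E\<close> at \<open>u\<close>: subtracting a suitable multiple of
  \<open>E (F\<^sup>j\<^sup>+\<^sup>1 (E\<^sup>j u))\<close> kills the top term \<open>E\<^sup>j u\<close>.\<close>
lemma E_surj_aux:
  assumes "u \<in> W w" "(E ^^ j) u = 0" "w > 0"
  shows "\<exists>x \<in> W (w - 2). E x = u"
  using assms(1,2)
proof (induction j arbitrary: u)
  case 0
  then show ?case using subspace_0[OF W_subspace] by (intro bexI[of _ 0]) auto
next
  case (Suc j)
  define v where "v = (E ^^ j) u"
  have v: "v \<in> W (w + 2 * int j)" "E v = 0"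
    using E_pow_W[OF Suc.prems(1)] Suc.prems(2) by (auto simp: v_def)
  \<comment> \<open>The vector \<open>v\<close> has weight \<open>w + 2 * j\<close>, which is at
    least \<open>j + 1\<close> because \<open>w\<close> is positive.\<close>
  obtain c where c: "c \<noteq> 0" "(E ^^ Suc j) ((F ^^ Suc j) v) = c *s v"
    using E_pow_F_pow[OF v, of "Suc j"] \<open>w > 0\<close> by auto
  define x where "x = (- inverse c) *s (F ^^ Suc j) v"
  have x: "x \<in> W (w - 2)"
    unfolding x_def
  proof (intro subspace_scale W_subspace)
    have "w + 2 * int j - 2 * int (Suc j) = w - 2" by simp
    then show "(F ^^ Suc j) v \<in> W (w - 2)"
      using F_pow_W[OF v(1), of "Suc j"] by metis
  qed
  have "(E ^^ j) (E ((F ^^ Suc j) v)) = c *s v"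
    using c(2) by (simp add: funpow_swap1)
  then have "(E ^^ j) (E x) = (- inverse c) *s c *s v"
    by (simp only: x_def E_scale E_pow_scale)
  then have "(E ^^ j) (u + E x) = 0"
    using c(1) by (simp add: E_pow_add v_def)
  moreover have "u + E x \<in> W w"
    using Suc.prems(1) E_W[OF x] by (intro subspace_add W_subspace) auto
  ultimately obtain y where y: "y \<in> W (w - 2)" "E y = u + E x"
    using Suc.IH by blast
  have "E y = E (y - x) + E x"
    using E_add[of "y - x" x] by simp
  then have "E (y - x) = u"
    unfolding y(2) by simp
  then show ?case
    using subspace_diff[OF W_subspace y(1) x] by blast
qed

lemma E_surj:
  assumes "u \<in> W w" "w > 0"
  shows "\<exists>x \<in> W (w - 2). E x = u"
proof (rule E_surj_aux[OF assms(1) _ assms(2)])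
  define M where "M = Suc (nat \<bar>N\<bar>)"
  have "W (w + 2 * int M) \<subseteq> {0}"
    by (rule W_bounded) (use assms(2) in \<open>auto simp: M_def\<close>)
  then show "(E ^^ M) u = 0"
    using E_pow_W[OF assms(1), of M] by blast
qed

text \<open>In weight 0 the operators commute, so \<open>F x\<close> is a vector of weight -2 killed
  by \<open>E\<close>.\<close>

lemma kernel_E_weight_0:
  assumes "x \<in> W 0" "E x = 0"
  shows "F x = 0"
proof (rule E_inj)
  show "F x \<in> W (- 2)" using F_W[OF assms(1)] by simp
  show "E (F x) = 0" using commutator[OF assms(1)] assms(2) by simp
qed simp

end

lemma (in sl2_rep) F_inj:
  assumes "x \<in> W w" "F x = 0" "w > 0"
  shows "x = 0"
proof -
  \<comment> \<open>Exchanging \<open>E\<close> and \<open>F\<close> while negating weights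
    preserves the axioms, so \<open>F_inj\<close> is \<open>E_inj\<close> for the dual
    structure.\<close>
  interpret dual: sl2_rep scale F E "\<lambda>w. W (- w)" N
  proof
    fix w x assume "x \<in> W (- w)"
    then show "F (E x) - E (F x) = of_int w *s x"
      using arg_cong[OF commutator, of x "- w" uminus] by simp
  next
    fix w x assume "x \<in> W (- w)"
    then show "F x \<in> W (- (w + 2))" "E x \<in> W (- (w - 2))"
      using F_W[of x "- w"] E_W[of x "- w"] by simp_all
  next
    fix w :: int assume "N < \<bar>w\<bar>"
    then show "W (- w) \<subseteq> {0}" by (intro W_bounded) simp
  qed (rule E_add E_scale F_add F_scale W_subspace)+
  show ?thesis using dual.E_inj[of x "- w"] assms by simp
qed

section \<open>Monomials of given degree and weight\<close>

lemma total_degree_add: "total_degree (m + m') = total_degree m + total_degree m'"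
  unfolding total_degree_def by (rule setsum_keys_plus_distrib) auto

lemma total_degree_single [simp]: "total_degree (Poly_Mapping.single v a) = a"
  by (auto simp: total_degree_def)

lemma total_degree_eq_0_iff: "total_degree m = 0 \<longleftrightarrow> m = 0"
  by (auto simp: total_degree_def in_keys_iff intro: poly_mapping_eqI)

lemma monom_minus_single:
  fixes m :: "'a \<Rightarrow>\<^sub>0 nat"
  assumes "v \<in> Poly_Mapping.keys m"
  shows "m - Poly_Mapping.single v 1 + Poly_Mapping.single v 1 = m"
  using assms
  by (intro poly_mapping_eqI) (auto simp: lookup_add lookup_minus lookup_single when_def in_keys_iff)

lemma keys_plus_nat: "Poly_Mapping.keys (m + m' :: 'a \<Rightarrow>\<^sub>0 nat) = Poly_Mapping.keys m \<union> Poly_Mapping.keys m'"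
  by (auto simp: in_keys_iff lookup_add)

definition monoms :: "(nat \<times> nat) set \<Rightarrow> nat \<Rightarrow> monom set" where
  "monoms V a = {m. Poly_Mapping.keys m \<subseteq> V \<and> total_degree m = a}"

lemma monoms_0: "monoms V 0 = {0}"
  by (auto simp: monoms_def total_degree_eq_0_iff)

lemma monoms_empty: "monoms {} (Suc a) = {}"
  using keys_eq_empty by (auto simp: monoms_def total_degree_def)

text \<open>A monomial either avoids \<open>v\<close> or can be divided by it once; on cardinalities
  this is Pascal's rule.\<close>

lemma monoms_insert:
  "monoms (insert v V) (Suc a) = monoms V (Suc a) \<union> (\<lambda>m. m + Poly_Mapping.single v 1) ` monoms (insert v V) a"
proof (intro equalityI subsetI)
  fix m assume m: "m \<in> monoms (insert v V) (Suc a)"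
  show "m \<in> monoms V (Suc a) \<union> (\<lambda>m. m + Poly_Mapping.single v 1) ` monoms (insert v V) a"
  proof (cases "v \<in> Poly_Mapping.keys m")
    case True
    define m' where "m' = m - Poly_Mapping.single v 1"
    have m': "m = m' + Poly_Mapping.single v 1"
      unfolding m'_def monom_minus_single[OF True] ..
    with m have "m' \<in> monoms (insert v V) a"
      by (auto simp: monoms_def keys_plus_nat total_degree_add)
    then show ?thesis using m' by blast
  qed (use m in \<open>auto simp: monoms_def\<close>)
qed (auto simp: monoms_def keys_plus_nat total_degree_add)

text \<open>Stars and bars. For empty \<open>V\<close> and \<open>a = 0\<close> the truncated
  subtraction gives 0 choose 0, which is 1 as it should be.\<close>

lemma finite_card_monoms:
  assumes "finite V"
  shows "finite (monoms V a) \<and> card (monoms V a) = (card V + a - 1) choose a"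
  using assms
proof (induction V arbitrary: a rule: finite_induct)
  case empty
  show ?case by (cases a) (auto simp: monoms_0 monoms_empty)
next
  case (insert v V)
  show ?case
  proof (induction a)
    case (Suc a)
    let ?f = "\<lambda>m. m + Poly_Mapping.single v (1 :: nat)"
    have "monoms V (Suc a) \<inter> ?f ` monoms (insert v V) a = {}"
      using insert.hyps by (auto simp: monoms_def keys_plus_nat)
    moreover have "inj_on ?f A" for A by (rule inj_onI) simp
    ultimately show ?case
      using Suc.IH insert.IH[of "Suc a"] insert.hyps
      by (simp add: monoms_insert card_Un_disjoint card_image)
  qed (simp add: monoms_0)
qed

definition weight :: "monom \<Rightarrow> int" where
  "weight m = (\<Sum>v\<in>Poly_Mapping.keys m. (if snd v = 0 then 1 else - 1) * int (Poly_Mapping.lookup m v))"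

lemma weight_add: "weight (m + m') = weight m + weight m'"
  unfolding weight_def by (rule setsum_keys_plus_distrib) (auto simp: algebra_simps)

lemma weight_single [simp]: "weight (Poly_Mapping.single v a) = (if snd v = 0 then int a else - int a)"
  by (auto simp: weight_def)

lemma weight_bound: "\<bar>weight m\<bar> \<le> int (total_degree m)"
  unfolding weight_def total_degree_def of_nat_sum
  by (rule order_trans[OF sum_abs]) (auto intro!: sum_mono simp: abs_mult)

lemma weight_eq:
  assumes "Poly_Mapping.keys m \<subseteq> UNIV \<times> {i}"
  shows "weight m = (if i = 0 then 1 else - 1) * int (total_degree m)"
  using assms unfolding weight_def total_degree_def of_nat_sum sum_distrib_left
  by (intro sum.cong) auto

definition linvars :: "nat \<Rightarrow> (nat \<times> nat) set" where
  "linvars n = {..<n} \<times> {0, 1}"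

lemma vars_replicate_1: "vars (replicate n 1) = linvars n"
  by (auto simp: vars_def linvars_def)

lemma finite_linvars: "finite (linvars n)"
  by (simp add: linvars_def)

lemma finite_monoms_linvars: "finite (monoms (linvars n) N)"
  using finite_card_monoms[OF finite_linvars] by blast

lemma monoms_linvars_split:
  fixes m :: monom
  assumes "Poly_Mapping.keys m \<subseteq> linvars n"
  obtains p q where "m = p + q" "Poly_Mapping.keys p \<subseteq> {..<n} \<times> {0}" "Poly_Mapping.keys q \<subseteq> {..<n} \<times> {1}"
proof
  define part where "part i = (\<Sum>v\<in>{..<n} \<times> {i}. Poly_Mapping.single v (Poly_Mapping.lookup m v))" for i :: nat
  have lookup: "Poly_Mapping.lookup (part i) v = (if v \<in> {..<n} \<times> {i} then Poly_Mapping.lookup m v else 0)" for i v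
    by (auto simp: part_def lookup_sum lookup_single when_def sum.delta)
  show "m = part 0 + part 1"
  proof (rule poly_mapping_eqI)
    fix v
    have "Poly_Mapping.lookup m v \<noteq> 0 \<Longrightarrow> v \<in> {..<n} \<times> {0, 1}"
      using assms unfolding linvars_def in_keys_iff[symmetric] by blast
    then show "Poly_Mapping.lookup m v = Poly_Mapping.lookup (part 0 + part 1) v"
      by (cases v) (auto simp: lookup lookup_add)
  qed
  show "Poly_Mapping.keys (part 0) \<subseteq> {..<n} \<times> {0}" "Poly_Mapping.keys (part 1) \<subseteq> {..<n} \<times> {1}"
    by (auto simp: in_keys_iff lookup split: if_splits)
qed

lemma bidegree:
  assumes "Poly_Mapping.keys p \<subseteq> {..<n} \<times> {0}" "Poly_Mapping.keys q \<subseteq> {..<n} \<times> {1}"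
  shows "total_degree (p + q) = total_degree p + total_degree q"
    "weight (p + q) = int (total_degree p) - int (total_degree q)"
proof -
  have "weight p = int (total_degree p)" "weight q = - int (total_degree q)"
    using weight_eq[of p 0] weight_eq[of q 1] assms by fastforce+
  then show "weight (p + q) = int (total_degree p) - int (total_degree q)"
    by (simp add: weight_add)
qed (rule total_degree_add)

text \<open>Degree \<open>a + b\<close> and weight \<open>a - b\<close> determine the degrees
  \<open>a\<close> and \<open>b\<close> in the two kinds of variables, and a monomial factors
  uniquely into its two parts.\<close>

lemma card_bidegree:
  "card {m \<in> monoms (linvars n) (a + b). weight m = int a - int b} =
     ((n + a - 1) choose a) * ((n + b - 1) choose b)"
proof -
  let ?V = "\<lambda>i::nat. {..<n} \<times> {i}"
  have "bij_betw (\<lambda>(p, q). p + q) (monoms (?V 0) a \<times> monoms (?V 1) b)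
      {m \<in> monoms (linvars n) (a + b). weight m = int a - int b}"
  proof (rule bij_betwI')
    fix x y assume "x \<in> monoms (?V 0) a \<times> monoms (?V 1) b" "y \<in> monoms (?V 0) a \<times> monoms (?V 1) b"
    then obtain p q p' q' where eq: "x = (p, q)" "y = (p', q')"
      and k: "Poly_Mapping.keys p \<subseteq> ?V 0" "Poly_Mapping.keys p' \<subseteq> ?V 0"
        "Poly_Mapping.keys q \<subseteq> ?V 1" "Poly_Mapping.keys q' \<subseteq> ?V 1"
      by (auto simp: monoms_def)
    have "p = p' \<and> q = q'" if "p + q = p' + q'"
    proof -
      have sum: "Poly_Mapping.lookup p v + Poly_Mapping.lookup q v = Poly_Mapping.lookup p' v + Poly_Mapping.lookup q' v" for v
        using that by (metis lookup_add)
      have z: "snd v \<noteq> 0 \<Longrightarrow> Poly_Mapping.lookup p v = 0 \<and> Poly_Mapping.lookup p' v = 0"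
        "snd v = 0 \<Longrightarrow> Poly_Mapping.lookup q v = 0 \<and> Poly_Mapping.lookup q' v = 0" for v
        using k by (auto simp: in_keys_iff)
      have "Poly_Mapping.lookup p v = Poly_Mapping.lookup p' v \<and> Poly_Mapping.lookup q v = Poly_Mapping.lookup q' v" for v
        using sum[of v] z[of v] by (cases "snd v = 0") auto
      then show ?thesis by (auto intro: poly_mapping_eqI)
    qed
    then show "((\<lambda>(p, q). p + q) x = (\<lambda>(p, q). p + q) y) = (x = y)"
      unfolding eq by auto
  next
    fix x assume "x \<in> monoms (?V 0) a \<times> monoms (?V 1) b"
    then obtain p q where eq: "x = (p, q)"
      and k: "Poly_Mapping.keys p \<subseteq> ?V 0" "Poly_Mapping.keys q \<subseteq> ?V 1"
        "total_degree p = a" "total_degree q = b"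
      by (auto simp: monoms_def)
    show "(\<lambda>(p, q). p + q) x \<in> {m \<in> monoms (linvars n) (a + b). weight m = int a - int b}"
      using bidegree[OF k(1,2)] k unfolding eq by (auto simp: monoms_def keys_plus_nat linvars_def)
  next
    fix m assume m: "m \<in> {m \<in> monoms (linvars n) (a + b). weight m = int a - int b}"
    then obtain p q where pq: "m = p + q" "Poly_Mapping.keys p \<subseteq> ?V 0" "Poly_Mapping.keys q \<subseteq> ?V 1"
      using monoms_linvars_split[of m n] by (auto simp: monoms_def)
    have "total_degree p = a" "total_degree q = b"
      using m bidegree[OF pq(2,3)] by (auto simp: monoms_def pq(1))
    then show "\<exists>x \<in> monoms (?V 0) a \<times> monoms (?V 1) b. m = (\<lambda>(p, q). p + q) x"
      using pq by (intro bexI[of _ "(p, q)"]) (auto simp: monoms_def)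
  qed
  then have "card {m \<in> monoms (linvars n) (a + b). weight m = int a - int b} =
      card (monoms (?V 0) a \<times> monoms (?V 1) b)"
    by (rule bij_betw_same_card[symmetric])
  then show ?thesis
    using finite_card_monoms[of "?V 0" a] finite_card_monoms[of "?V 1" b]
    by (simp add: card_cartesian_product)
qed

text \<open>With bidegree (a, b), N - c is 2b and N + c is 2a, whence the parity condition. Writing
  the number of variables of each kind as \<open>Suc K\<close> turns the counts into binomials over
  the fixed lower index \<open>K\<close>.\<close>

lemma card_weight:
  "card {m \<in> monoms (linvars (Suc K)) N. weight m = int c} =
     (if c \<le> N \<and> even (N - c)
      then ((K + (N - c) div 2) choose K) * ((K + (N + c) div 2) choose K) else 0)"
proof (cases "c \<le> N \<and> even (N - c)")
  case True
  define a b where "a = (N + c) div 2" and "b = (N - c) div 2"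
  have "N = a + b" "int c = int a - int b"
    using True unfolding a_def b_def by presburger+
  then show ?thesis
    using True card_bidegree[of "Suc K" a b] binomial_symmetric[of K "K + a"] binomial_symmetric[of K "K + b"]
    by (simp add: a_def b_def mult.commute)
next
  case False
  have "{m \<in> monoms (linvars (Suc K)) N. weight m = int c} = {}"
  proof (rule ccontr)
    assume "\<not> ?thesis"
    then obtain m where m: "Poly_Mapping.keys m \<subseteq> linvars (Suc K)" "total_degree m = N" "weight m = int c"
      by (auto simp: monoms_def)
    obtain p q where pq: "m = p + q" "Poly_Mapping.keys p \<subseteq> {..<Suc K} \<times> {0}" "Poly_Mapping.keys q \<subseteq> {..<Suc K} \<times> {1}"
      using monoms_linvars_split[OF m(1)] .
    have "total_degree p = c + total_degree q" "N = c + 2 * total_degree q"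
      using m bidegree[OF pq(2,3)] by (auto simp: pq(1))
    then show False using False by auto
  qed
  then show ?thesis by (simp only: False if_False card.empty)
qed

section \<open>The derivations as raising and lowering operators\<close>

definition supported :: "monom set \<Rightarrow> 'k::field mpoly set" where
  "supported A = {p. Poly_Mapping.keys p \<subseteq> A}"

lemma lookup_scale [simp]: "Poly_Mapping.lookup (scale c p) m = c * Poly_Mapping.lookup p m"
  by (simp add: scale_def mult_map_scale_conv_mult[symmetric] Poly_Mapping.map.rep_eq when_def)

lemma mpoly_eq_sum: "p = (\<Sum>m\<in>Poly_Mapping.keys p. Poly_Mapping.single m (Poly_Mapping.lookup p m))"
  by (rule poly_mapping_eqI) (simp add: lookup_sum lookup_single when_def in_keys_iff sum.delta)

lemma subspace_supported: "mpoly.subspace (supported A)"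
  unfolding mpoly.subspace_def
proof (intro conjI ballI allI)
  fix p q :: "'a mpoly" and c assume "p \<in> supported A" "q \<in> supported A"
  then show "p + q \<in> supported A" "scale c p \<in> supported A"
    using keys_add[of p q] by (auto simp: supported_def in_keys_iff)
qed (simp add: supported_def)

lemma single_in_supported: "m \<in> A \<Longrightarrow> Poly_Mapping.single m c \<in> supported A"
  by (simp add: supported_def)

lemma scale_single: "scale c (Poly_Mapping.single m 1) = Poly_Mapping.single m c"
  by (simp add: scale_def mult_single)

lemma supported_span: "supported A = mpoly.span ((\<lambda>m. Poly_Mapping.single m 1) ` A)"
proof
  show "supported A \<subseteq> mpoly.span ((\<lambda>m. Poly_Mapping.single m (1 :: 'a)) ` A)"
  proof
    fix p :: "'a mpoly" assume p: "p \<in> supported A"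
    have "(\<Sum>m\<in>Poly_Mapping.keys p. scale (Poly_Mapping.lookup p m) (Poly_Mapping.single m 1)) \<in>
        mpoly.span ((\<lambda>m. Poly_Mapping.single m (1 :: 'a)) ` A)"
      using p by (intro mpoly.span_sum mpoly.span_scale mpoly.span_base) (auto simp: supported_def)
    then show "p \<in> mpoly.span ((\<lambda>m. Poly_Mapping.single m (1 :: 'a)) ` A)"
      unfolding scale_single mpoly_eq_sum[symmetric] .
  qed
  show "mpoly.span ((\<lambda>m. Poly_Mapping.single m (1 :: 'a)) ` A) \<subseteq> supported A"
    by (intro mpoly.span_minimal subspace_supported) (auto intro: single_in_supported)
qed

lemma dim_supported:
  assumes "finite A"
  shows "mpoly.dim (supported A :: 'k::field mpoly set) = card A"
proof -
  let ?e = "\<lambda>m. Poly_Mapping.single m (1 :: 'k)"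
  have inj: "inj_on ?e A" by (rule inj_onI) (metis keys_single one_neq_zero singleton_inject)
  have "mpoly.independent (?e ` A)"
  proof (rule mpoly.independent_if_scalars_zero)
    fix f x assume sum: "(\<Sum>x\<in>?e ` A. scale (f x) x) = 0" and "x \<in> ?e ` A"
    then obtain m where m: "x = ?e m" "m \<in> A" by auto
    have "0 = Poly_Mapping.lookup (\<Sum>m\<in>A. scale (f (?e m)) (?e m)) m"
      using sum by (simp add: sum.reindex[OF inj])
    also have "\<dots> = f x"
      using m assms
      by (simp add: lookup_sum lookup_single when_def if_distrib[of "(*) _"] cong: if_cong)
    finally show "f x = 0" by simp
  qed (use assms in simp)
  then show ?thesis
    unfolding supported_span mpoly.dim_span using card_image[OF inj]
    by (simp add: mpoly.dim_eq_card_independent)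
qed

section \<open>Derivations sending variables to multiples of variables\<close>

lemma derivation_linear: "Vector_Spaces.linear scale scale (derivation g)"
  by unfold_locales (auto simp: derivation_add derivation_scale)

lemma derivation_sum: "derivation g (sum f A) = (\<Sum>x\<in>A. derivation g (f x))"
  by (induction A rule: infinite_finite_induct) (auto simp: derivation_add)

text \<open>Each term of the derivative of a monomial replaces one factor \<open>v\<close> by
  \<open>s v\<close>, so only these exchanges have to be checked. Variables with
  \<open>c v = 0\<close>, such as the boundary ones, contribute no term.\<close>

lemma derivation_supported:
  assumes g: "\<And>v. g v = Poly_Mapping.single (Poly_Mapping.single (s v) 1) (c v)"
    and AB: "\<And>m v. m \<in> A \<Longrightarrow> v \<in> Poly_Mapping.keys m \<Longrightarrow> c v \<noteq> 0 \<Longrightarrow>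
      m - Poly_Mapping.single v 1 + Poly_Mapping.single (s v) 1 \<in> B"
    and p: "p \<in> supported A"
  shows "derivation g p \<in> supported B"
  unfolding derivation_def
proof (intro mpoly.subspace_sum subspace_supported)
  fix m v assume m: "m \<in> Poly_Mapping.keys p" "v \<in> Poly_Mapping.keys m"
  show "Poly_Mapping.single (m - Poly_Mapping.single v 1)
      (Poly_Mapping.lookup p m * of_nat (Poly_Mapping.lookup m v)) * g v \<in> supported B"
  proof (cases "c v = 0")
    case True
    then show ?thesis by (simp add: g supported_def)
  next
    case False
    have "m \<in> A" using m p by (auto simp: supported_def)
    from AB[OF this m(2) False] show ?thesis
      unfolding g mult_single by (rule single_in_supported)
  qed
qed

text \<open>A weighted form of Euler's identity. Only variables occurring in \<open>p\<close> are
  constrained, so \<open>h\<close> may be arbitrary elsewhere.\<close>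

lemma derivation_eigen:
  assumes "\<And>m v. m \<in> Poly_Mapping.keys p \<Longrightarrow> v \<in> Poly_Mapping.keys m \<Longrightarrow>
      h v = Poly_Mapping.single (Poly_Mapping.single v 1) (e v)"
    and "\<And>m. m \<in> Poly_Mapping.keys p \<Longrightarrow>
      (\<Sum>v\<in>Poly_Mapping.keys m. e v * of_nat (Poly_Mapping.lookup m v)) = w"
  shows "derivation h p = scale w p"
proof -
  have "derivation h p = (\<Sum>m\<in>Poly_Mapping.keys p. Poly_Mapping.single m (w * Poly_Mapping.lookup p m))"
    unfolding derivation_def
  proof (rule sum.cong)
    fix m assume m: "m \<in> Poly_Mapping.keys p"
    have "(\<Sum>v\<in>Poly_Mapping.keys m. Poly_Mapping.single (m - Poly_Mapping.single v 1)
          (Poly_Mapping.lookup p m * of_nat (Poly_Mapping.lookup m v)) * h v) =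
        (\<Sum>v\<in>Poly_Mapping.keys m. scale (Poly_Mapping.lookup p m * (e v * of_nat (Poly_Mapping.lookup m v)))
          (Poly_Mapping.single m 1))"
      using monom_minus_single[of _ m] assms(1)[OF m]
      by (intro sum.cong) (simp_all add: mult_single scale_single algebra_simps)
    also have "\<dots> = scale (Poly_Mapping.lookup p m * w) (Poly_Mapping.single m 1)"
      unfolding mpoly.scale_sum_left[symmetric] sum_distrib_left[symmetric] assms(2)[OF m] ..
    finally show "(\<Sum>v\<in>Poly_Mapping.keys m. Poly_Mapping.single (m - Poly_Mapping.single v 1)
          (Poly_Mapping.lookup p m * of_nat (Poly_Mapping.lookup m v)) * h v) =
        Poly_Mapping.single m (w * Poly_Mapping.lookup p m)"
      by (simp add: scale_single mult.commute)
  qed simp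
  also have "\<dots> = scale w p"
    by (rule poly_mapping_eqI) (simp add: lookup_sum lookup_single when_def in_keys_iff sum.delta)
  finally show ?thesis .
qed

text \<open>Taking a set of weights lets the same statements cover single weight spaces, all weights
  \<open>\<ge> 0\<close>, and the whole homogeneous component.\<close>

definition wmonoms :: "nat \<Rightarrow> nat \<Rightarrow> int set \<Rightarrow> monom set" where
  "wmonoms n N S = {m \<in> monoms (linvars n) N. weight m \<in> S}"

lemma finite_wmonoms: "finite (wmonoms n N S)"
  unfolding wmonoms_def by (simp add: finite_monoms_linvars)

abbreviation Dstar :: "nat \<Rightarrow> 'k::field mpoly \<Rightarrow> 'k mpoly" where
  "Dstar n \<equiv> Dstar_op (replicate n 1)"

lemma monoms_exchange:
  assumes "m \<in> monoms V N" "v \<in> Poly_Mapping.keys m" "v' \<in> V"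
  shows "m - Poly_Mapping.single v 1 + Poly_Mapping.single v' 1 \<in> monoms V N"
    and "weight (m - Poly_Mapping.single v 1 + Poly_Mapping.single v' 1) =
      weight m - (if snd v = 0 then 1 else - 1) + (if snd v' = 0 then 1 else - 1)"
proof -
  let ?m = "m - Poly_Mapping.single v 1"
  have m: "m = ?m + Poly_Mapping.single v 1" using monom_minus_single[OF assms(2)] by simp
  have "Poly_Mapping.keys ?m \<subseteq> Poly_Mapping.keys m" by (auto simp: in_keys_iff lookup_minus)
  then show "?m + Poly_Mapping.single v' 1 \<in> monoms V N"
    using assms arg_cong[OF m, of total_degree]
    by (auto simp: monoms_def keys_plus_nat total_degree_add)
  show "weight (?m + Poly_Mapping.single v' 1) =
      weight m - (if snd v = 0 then 1 else - 1) + (if snd v' = 0 then 1 else - 1)"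
    using arg_cong[OF m, of weight] by (auto simp: weight_add)
qed

text \<open>\<open>Dop\<close> trades one x_1 for an x_0 and kills x_0, so every weight rises by
  2.\<close>

lemma Dop_supported:
  assumes "p \<in> supported (wmonoms n N S)"
  shows "Dop p \<in> supported (wmonoms n N ((+) 2 ` S))"
  unfolding Dop_def
proof (rule derivation_supported[OF _ _ assms])
  show "(case v of (k, i) \<Rightarrow> scale (of_nat i) (Var k (i - 1))) =
      Poly_Mapping.single (Poly_Mapping.single (fst v, snd v - 1) 1) (of_nat (snd v))" for v
    by (cases v) (simp add: scale_single)
next
  fix m v assume "m \<in> wmonoms n N S" and v: "v \<in> Poly_Mapping.keys m" "(of_nat (snd v) :: 'a) \<noteq> 0"
  then have m: "m \<in> monoms (linvars n) N" "weight m \<in> S" "v \<in> linvars n" "snd v \<noteq> 0"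
    by (auto simp: wmonoms_def monoms_def simp del: of_nat_eq_0_iff intro: ccontr)
  then have "snd v = 1" "fst v < n" by (auto simp: linvars_def)
  then show "m - Poly_Mapping.single v 1 + Poly_Mapping.single (fst v, snd v - 1) 1 \<in> wmonoms n N ((+) 2 ` S)"
    using monoms_exchange[OF m(1) v(1), of "(fst v, 0)"] m(2)
    by (auto simp: wmonoms_def linvars_def)
qed

text \<open>\<open>Dstar n\<close> trades one x_0 for an x_1; the coefficient 1 - 1 removes the
  terms that would leave the linear variables.\<close>

lemma Dstar_supported:
  assumes "p \<in> supported (wmonoms n N S)"
  shows "Dstar n p \<in> supported (wmonoms n N ((+) (- 2) ` S))"
  unfolding Dstar_op_def
proof (rule derivation_supported[OF _ _ assms])
  show "(case v of (k, i) \<Rightarrow> scale (of_nat (replicate n 1 ! k - i)) (Var k (i + 1))) =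
      Poly_Mapping.single (Poly_Mapping.single (fst v, snd v + 1) 1) (of_nat (replicate n 1 ! fst v - snd v))" for v
    by (cases v) (simp add: scale_single)
next
  fix m v assume "m \<in> wmonoms n N S" and v: "v \<in> Poly_Mapping.keys m" "(of_nat (replicate n 1 ! fst v - snd v) :: 'a) \<noteq> 0"
  then have m: "m \<in> monoms (linvars n) N" "weight m \<in> S" "v \<in> linvars n"
    by (auto simp: wmonoms_def monoms_def)
  then have "fst v < n" by (auto simp: linvars_def)
  moreover from this have "snd v = 0" using v(2) m(3) by (auto simp: linvars_def)
  ultimately show "m - Poly_Mapping.single v 1 + Poly_Mapping.single (fst v, snd v + 1) 1 \<in> wmonoms n N ((+) (- 2) ` S)"
    using monoms_exchange[OF m(1) v(1), of "(fst v, 1)"] m(2)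
    by (auto simp: wmonoms_def linvars_def)
qed

text \<open>The commutator of two derivations is a derivation, hence determined by its values on
  variables. It fixes each x_0 and negates each x_1, so \<open>derivation_eigen\<close> yields the
  weight as eigenvalue.\<close>

lemma Dop_Dstar_commutator:
  assumes "p \<in> supported (wmonoms n N {w})"
  shows "Dop (Dstar n p) - Dstar n (Dop p) = scale (of_int w) (p :: 'k::field mpoly)"
proof -
  let ?E = "\<lambda>p :: 'k mpoly. Dop (Dstar n p) - Dstar n (Dop p)"
  have E: "?E q = derivation (\<lambda>(k, i). ?E (Var k i)) q" for q
    by (rule derivation_unique)
       (simp_all add: Dop_def Dstar_op_def derivation_add derivation_scale derivation_mult
         algebra_simps mpoly.scale_right_diff_distrib)
  have Dop_Var: "Dop (Var k i :: 'k mpoly) = scale (of_nat i) (Var k (i - 1))" for k i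
    by (simp only: Dop_def derivation_Var prod.case)
  \<comment> \<open>The bound on \<open>k\<close> matters: beyond the end of the list the entry
    \<open>replicate n 1 ! k\<close> is unspecified.\<close>
  have Dstar_Var: "k < n \<Longrightarrow> Dstar n (Var k i :: 'k mpoly) = scale (of_nat (1 - i)) (Var k (i + 1))" for k i
    by (simp only: Dstar_op_def derivation_Var prod.case List.nth_replicate)
  have Dop_0: "Dop (0 :: 'k mpoly) = 0" and Dstar_0: "Dstar n (0 :: 'k mpoly) = 0"
    by (simp_all add: Dop_def Dstar_op_def)
  have Var: "?E (Var k i) = Poly_Mapping.single (Poly_Mapping.single (k, i) 1) (if i = 0 then 1 else - 1)"
    if "(k, i) \<in> linvars n" for k i
  proof -
    have k: "k < n" and i: "i = 0 \<or> i = 1" using that by (auto simp: linvars_def)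
    have D: "Dop (Var k 0 :: 'k mpoly) = 0" "Dop (Var k 1 :: 'k mpoly) = Var k 0"
      "Dstar n (Var k 0 :: 'k mpoly) = Var k 1" "Dstar n (Var k 1 :: 'k mpoly) = 0"
      using Dop_Var[of k 0] Dop_Var[of k 1] Dstar_Var[OF k, of 0] Dstar_Var[OF k, of 1]
      by (simp_all del: One_nat_def)
    from i show ?thesis
    proof
      assume "i = 0"
      then show ?thesis by (simp only: D Dop_0 Dstar_0 diff_zero simp_thms if_True)
    next
      assume "i = 1"
      then show ?thesis
        by (simp only: D Dop_0 Dstar_0 diff_0 one_neq_zero simp_thms if_False single_uminus)
    qed
  qed
  show ?thesis
    unfolding E[of p]
  proof (rule derivation_eigen[where e = "\<lambda>v. if snd v = 0 then 1 else - 1"])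
    fix m v assume "m \<in> Poly_Mapping.keys p" "v \<in> Poly_Mapping.keys m"
    then have "v \<in> linvars n"
      using assms by (auto simp: supported_def wmonoms_def monoms_def)
    then show "(case v of (k, i) \<Rightarrow> ?E (Var k i)) =
        Poly_Mapping.single (Poly_Mapping.single v 1) (if snd v = 0 then 1 else - 1)"
      using Var by (cases v) (simp del: One_nat_def)
  next
    fix m assume "m \<in> Poly_Mapping.keys p"
    then have "of_int (weight m) = (of_int w :: 'k)"
      using assms by (auto simp: supported_def wmonoms_def)
    then show "(\<Sum>v\<in>Poly_Mapping.keys m. (if snd v = 0 then 1 else - 1) * of_nat (Poly_Mapping.lookup m v)) = (of_int w :: 'k)"
      unfolding weight_def of_int_sum by (simp add: if_distrib[of of_int] cong: if_cong)
  qed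
qed

text \<open>Both operators preserve the total degree, and fixing it at \<open>N\<close> bounds all
  weights by \<open>N\<close>.\<close>

lemma sl2_rep_polys:
  "sl2_rep (scale :: 'k::field_char_0 \<Rightarrow> _) Dop (Dstar n) (\<lambda>w. supported (wmonoms n N {w})) (int N)"
proof
  fix w and p :: "'k mpoly"
  assume p: "p \<in> supported (wmonoms n N {w})"
  show "Dop p \<in> supported (wmonoms n N {w + 2})" "Dstar n p \<in> supported (wmonoms n N {w - 2})"
    using Dop_supported[OF p] Dstar_supported[OF p] by (simp_all add: add.commute)
  show "Dop (Dstar n p) - Dstar n (Dop p) = scale (of_int w) p"
    by (rule Dop_Dstar_commutator[OF p])
next
  fix w :: int assume "int N < \<bar>w\<bar>"
  then have "wmonoms n N {w} = {}"
    using weight_bound by (auto simp: wmonoms_def monoms_def) (metis not_less)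
  then show "supported (wmonoms n N {w}) \<subseteq> {0 :: 'k mpoly}" by (simp add: supported_def)
qed (simp_all add: Dop_def Dstar_op_def derivation_add derivation_scale subspace_supported)

section \<open>Decomposition into weight components\<close>

definition weight_part :: "int \<Rightarrow> 'k::field mpoly \<Rightarrow> 'k mpoly" where
  "weight_part w p = (\<Sum>m | m \<in> Poly_Mapping.keys p \<and> weight m = w. Poly_Mapping.single m (Poly_Mapping.lookup p m))"

lemma lookup_weight_part:
  "Poly_Mapping.lookup (weight_part w p) m = (if weight m = w then Poly_Mapping.lookup p m else 0)"
  by (auto simp: weight_part_def lookup_sum lookup_single when_def sum.delta in_keys_iff)

lemma weight_part_supported:
  assumes "p \<in> supported (wmonoms n N S)"
  shows "weight_part w p \<in> supported (wmonoms n N {w})"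
  using assms by (auto simp: supported_def wmonoms_def in_keys_iff lookup_weight_part split: if_splits)

lemma sum_weight_part: "p = (\<Sum>w\<in>weight ` Poly_Mapping.keys p. weight_part w p)"
  by (rule poly_mapping_eqI) (auto simp: lookup_sum lookup_weight_part in_keys_iff sum.delta)

text \<open>A derivation shifting all weights by \<open>s\<close> sends different components to
  different weights, so their images cannot cancel and each must vanish separately.\<close>

lemma derivation_weight_part_eq_0:
  assumes shift: "\<And>w q. q \<in> supported (wmonoms n N {w}) \<Longrightarrow> derivation g q \<in> supported (wmonoms n N {w + s})"
    and p: "p \<in> supported (wmonoms n N S)" and "derivation g p = 0"
  shows "derivation g (weight_part w p) = 0"
proof (rule poly_mapping_eqI)
  fix m
  let ?W = "weight ` Poly_Mapping.keys p"
  have supp: "derivation g (weight_part u p) \<in> supported (wmonoms n N {u + s})" for u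
    by (rule shift[OF weight_part_supported[OF p]])
  have weight_m: "weight m = u + s" if "Poly_Mapping.lookup (derivation g (weight_part u p)) m \<noteq> 0" for u
    using supp[of u] that by (auto simp: supported_def wmonoms_def in_keys_iff)
  show "Poly_Mapping.lookup (derivation g (weight_part w p)) m = Poly_Mapping.lookup 0 m"
  proof (cases "weight m = w + s \<and> w \<in> ?W")
    case True
    have "0 = Poly_Mapping.lookup (derivation g (\<Sum>u\<in>?W. weight_part u p)) m"
      using assms(3) sum_weight_part[of p] by simp
    also have "\<dots> = (\<Sum>u\<in>?W. Poly_Mapping.lookup (derivation g (weight_part u p)) m)"
      by (simp add: derivation_sum lookup_sum)
    also have "\<dots> = (\<Sum>u\<in>{w}. Poly_Mapping.lookup (derivation g (weight_part u p)) m)"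
      using True by (intro sum.mono_neutral_right) (auto dest: weight_m)
    finally show ?thesis by simp
  next
    case False
    moreover have "weight_part w p = 0" if "w \<notin> ?W"
    proof (rule poly_mapping_eqI)
      fix k
      have "weight k = w \<Longrightarrow> k \<notin> Poly_Mapping.keys p" using that by blast
      then show "Poly_Mapping.lookup (weight_part w p) k = Poly_Mapping.lookup 0 k"
        by (simp add: lookup_weight_part in_keys_iff)
    qed
    ultimately show ?thesis
      using weight_m[of w] by auto
  qed
qed

lemma supported_mono: "A \<subseteq> B \<Longrightarrow> supported A \<subseteq> supported B"
  by (auto simp: supported_def)

lemma polys_Int_homogeneous: "polys (replicate n 1) \<inter> homogeneous N = supported (wmonoms n N UNIV)"
  unfolding polys_def homogeneous_def vars_replicate_1 by (auto simp: supported_def wmonoms_def monoms_def)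

lemma supported_wmonoms_iff:
  "p \<in> supported (wmonoms n N S) \<longleftrightarrow>
     p \<in> supported (wmonoms n N UNIV) \<and> (\<forall>w. w \<notin> S \<longrightarrow> weight_part w p = 0)"
proof
  assume p: "p \<in> supported (wmonoms n N S)"
  then have "weight_part w p = 0" if "w \<notin> S" for w
    using that by (intro poly_mapping_eqI) (auto simp: lookup_weight_part supported_def wmonoms_def in_keys_iff)
  moreover have "wmonoms n N S \<subseteq> wmonoms n N UNIV" by (auto simp: wmonoms_def)
  ultimately show "p \<in> supported (wmonoms n N UNIV) \<and> (\<forall>w. w \<notin> S \<longrightarrow> weight_part w p = 0)"
    using p supported_mono by blast
next
  assume p: "p \<in> supported (wmonoms n N UNIV) \<and> (\<forall>w. w \<notin> S \<longrightarrow> weight_part w p = 0)"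
  have "weight m \<in> S" if "m \<in> Poly_Mapping.keys p" for m
  proof (rule ccontr)
    assume "weight m \<notin> S"
    with p have "Poly_Mapping.lookup (weight_part (weight m) p) m = 0" by simp
    then show False using that by (simp add: lookup_weight_part in_keys_iff)
  qed
  then show "p \<in> supported (wmonoms n N S)" using p by (auto simp: supported_def wmonoms_def)
qed

section \<open>Invariants and semi-invariants in a fixed degree\<close>

context
  fixes n N :: nat and ty :: "'k::field_char_0 itself"
begin

interpretation sl2_rep "scale :: 'k \<Rightarrow> 'k mpoly \<Rightarrow> 'k mpoly" Dop "Dstar n"
  "\<lambda>w. supported (wmonoms n N {w})" "int N"
  by (rule sl2_rep_polys)

lemma Dop_weight_part_eq_0:
  assumes "(p :: 'k mpoly) \<in> supported (wmonoms n N S)" "Dop p = 0"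
  shows "Dop (weight_part w p) = 0"
  using derivation_weight_part_eq_0[OF E_W[unfolded Dop_def] assms(1)] assms(2)
  unfolding Dop_def by blast

lemma Dstar_weight_part_eq_0:
  assumes "(p :: 'k mpoly) \<in> supported (wmonoms n N S)" "Dstar n p = 0"
  shows "Dstar n (weight_part w p) = 0"
proof -
  have "q \<in> supported (wmonoms n N {u}) \<Longrightarrow> Dstar n q \<in> supported (wmonoms n N {u + - 2})"
    for u and q :: "'k mpoly"
    using F_W[of q u] by simp
  from derivation_weight_part_eq_0[OF this[unfolded Dstar_op_def] assms(1)] assms(2)
  show ?thesis unfolding Dstar_op_def by blast
qed

text \<open>Each weight component of a semi-invariant is again killed by \<open>Dop\<close>, and
  those of negative weight vanish by \<open>E_inj\<close>.\<close>

lemma semi_invariants_homogeneous: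
  "semi_invariants (replicate n 1) \<inter> homogeneous N =
     {p \<in> supported (wmonoms n N {0..}). Dop p = (0 :: 'k mpoly)}"
proof -
  have "weight_part w p = 0"
    if "p \<in> supported (wmonoms n N UNIV)" "Dop p = 0" "w < 0" for p :: "'k mpoly" and w
    using E_inj[OF weight_part_supported Dop_weight_part_eq_0] that by blast
  moreover have "semi_invariants (replicate n 1) \<inter> homogeneous N =
      {p \<in> supported (wmonoms n N UNIV). Dop p = (0 :: 'k mpoly)}"
    unfolding polys_Int_homogeneous[symmetric] semi_invariants_def by blast
  ultimately show ?thesis
    unfolding supported_wmonoms_iff[of _ n N "{0..}"] by (auto simp: not_le)
qed

text \<open>Negative components vanish by \<open>E_inj\<close>, positive ones by
  \<open>F_inj\<close>. On the remaining weight 0, \<open>kernel_E_weight_0\<close> derives the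
  condition on \<open>Dstar n\<close> from the one on \<open>Dop\<close>.\<close>

lemma invariants_homogeneous:
  "invariants (replicate n 1) \<inter> homogeneous N =
     {p \<in> supported (wmonoms n N {0}). Dop p = (0 :: 'k mpoly)}"
proof -
  have "weight_part w p = 0"
    if p: "p \<in> supported (wmonoms n N UNIV)" "Dop p = 0" "Dstar n p = 0" and "w \<noteq> 0" for p :: "'k mpoly" and w
  proof (cases "w < 0")
    case True
    then show ?thesis using E_inj[OF weight_part_supported Dop_weight_part_eq_0] p by blast
  next
    case False
    with \<open>w \<noteq> 0\<close> have "w > 0" by simp
    then show ?thesis using F_inj[OF weight_part_supported Dstar_weight_part_eq_0] p by blast
  qed
  moreover have "invariants (replicate n 1) \<inter> homogeneous N =
      {p \<in> supported (wmonoms n N UNIV). Dop p = (0 :: 'k mpoly) \<and> Dstar n p = 0}"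
    unfolding polys_Int_homogeneous[symmetric] invariants_def by blast
  ultimately show ?thesis
    using kernel_E_weight_0 supported_wmonoms_iff[of _ n N "{0}"] by blast
qed

text \<open>Weights above -2 are raised to positive weights, where \<open>E_surj\<close> provides a
  preimage of every monomial.\<close>

lemma Dop_image:
  assumes "\<And>w. w \<in> S \<Longrightarrow> w > - 2"
  shows "Dop ` supported (wmonoms n N S) = (supported (wmonoms n N ((+) 2 ` S)) :: 'k mpoly set)"
proof (intro equalityI subsetI)
  interpret D: Vector_Spaces.linear scale scale "Dop :: 'k mpoly \<Rightarrow> 'k mpoly"
    unfolding Dop_def by (rule derivation_linear)
  let ?I = "Dop ` supported (wmonoms n N S) :: 'k mpoly set"
  fix p :: "'k mpoly" assume p: "p \<in> supported (wmonoms n N ((+) 2 ` S))"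
  have "(\<Sum>m\<in>Poly_Mapping.keys p. Poly_Mapping.single m (Poly_Mapping.lookup p m)) \<in> ?I"
  proof (intro mpoly.subspace_sum D.subspace_image subspace_supported)
    fix m assume "m \<in> Poly_Mapping.keys p"
    then have "m \<in> wmonoms n N ((+) 2 ` S)" using p by (auto simp: supported_def)
    then obtain w where w: "w \<in> S" "weight m = w + 2" and m: "m \<in> wmonoms n N {w + 2}"
      by (auto simp: wmonoms_def)
    then obtain x where x: "x \<in> supported (wmonoms n N {w})"
        "Dop x = Poly_Mapping.single m (Poly_Mapping.lookup p m)"
      using E_surj[OF single_in_supported[OF m]] assms[OF w(1)] by fastforce
    have "wmonoms n N {w} \<subseteq> wmonoms n N S" using w(1) by (auto simp: wmonoms_def)
    then show "Poly_Mapping.single m (Poly_Mapping.lookup p m) \<in> ?I"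
      using x supported_mono by (metis imageI subsetD)
  qed
  then show "p \<in> ?I" using mpoly_eq_sum[of p] by simp
qed (auto intro: Dop_supported)

text \<open>Rank-nullity, with the image known from \<open>Dop_image\<close>, reduces the dimension
  to counting monomials. The cases of interest are \<open>S = {0}\<close> for invariants and
  \<open>S = {0..}\<close> for semi-invariants.\<close>

lemma dim_kernel_Dop:
  assumes "\<And>w. w \<in> S \<Longrightarrow> w > - 2"
  shows "mpoly.dim {p \<in> supported (wmonoms n N S). Dop p = (0 :: 'k mpoly)} +
    card (wmonoms n N ((+) 2 ` S)) = card (wmonoms n N S)"
proof -
  interpret D: Vector_Spaces.linear scale scale "Dop :: 'k mpoly \<Rightarrow> 'k mpoly"
    unfolding Dop_def by (rule derivation_linear)
  have image: "Dop ` supported (wmonoms n N S) = (supported (wmonoms n N ((+) 2 ` S)) :: 'k mpoly set)"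
    by (rule Dop_image) (rule assms)
  show ?thesis
    using D.dim_kernel_plus_dim_image[OF subspace_supported finite_imageI[OF finite_wmonoms]
        equalityD1[OF supported_span], of n N S]
    unfolding image dim_supported[OF finite_wmonoms] .
qed

end

section \<open>Generating functions\<close>

text \<open>The product (m+1)...(m+k) is written with \<open>fact k\<close> split off, so that it
  cancels the factorial in the denominator of the theorem's coefficients.\<close>

lemma fps_deriv_pow_nth:
  fixes f :: "'a::field_char_0 fps"
  shows "((fps_deriv ^^ k) f) $ m = fact k * of_nat ((m + k) choose k) * f $ (m + k)"
proof (induction k arbitrary: m)
  case (Suc k)
  have "((fps_deriv ^^ Suc k) f) $ m =
      of_nat (m + 1) * (fact k * of_nat ((m + Suc k) choose k)) * f $ (m + Suc k)"
    by (simp add: Suc.IH)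
  also have "of_nat (m + 1) * (fact k * of_nat ((m + Suc k) choose k)) =
      (fact (Suc k) * of_nat ((m + Suc k) choose Suc k) :: 'a)"
  proof -
    have "Suc k * ((m + Suc k) choose Suc k) = (m + Suc k) * ((m + Suc k - 1) choose k)"
      by (rule binomial_absorption)
    also have "\<dots> = (m + Suc k - k) * ((m + Suc k) choose k)"
      by (rule binomial_absorb_comp[symmetric])
    also have "m + Suc k - k = Suc m" by simp
    finally have "Suc k * ((m + Suc k) choose Suc k) = Suc m * ((m + Suc k) choose k)" .
    then have "fact k * (Suc k * ((m + Suc k) choose Suc k)) = fact k * (Suc m * ((m + Suc k) choose k))"
      by simp
    then have "of_nat (fact k * (Suc k * ((m + Suc k) choose Suc k))) =
        (of_nat (fact k * (Suc m * ((m + Suc k) choose k))) :: 'a)"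
      by (rule arg_cong)
    then show ?thesis by (simp add: algebra_simps)
  qed
  finally show ?case .
qed simp

text \<open>The negative binomial series in X^2. By Pascal's rule, multiplying the series for
  \<open>Suc M\<close> by \<open>1 - fps_X ^ 2\<close> gives the series for
  \<open>M\<close>.\<close>

lemma inverse_one_minus_fps_X_squared_power:
  "inverse ((1 - fps_X ^ 2) ^ Suc M) =
     (Abs_fps (\<lambda>m. if even m then of_nat ((M + m div 2) choose M) else 0) :: 'a::field_char_0 fps)"
    (is "_ = ?g M")
proof (rule fps_inverse_unique)
  have diff: "(1 - fps_X ^ 2) * f = Abs_fps (\<lambda>m. f $ m - (if m < 2 then 0 else f $ (m - 2)))"
    for f :: "'a fps"
    by (rule fps_ext) (simp add: algebra_simps fps_X_power_mult_right_nth)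
  show "(1 - fps_X ^ 2) ^ Suc M * ?g M = 1"
  proof (induction M)
    case 0
    show ?case by (rule fps_ext) (auto simp: diff)
  next
    case (Suc M)
    have "(1 - fps_X ^ 2) * ?g (Suc M) = ?g M"
    proof (rule fps_ext)
      fix m
      show "((1 - fps_X ^ 2) * ?g (Suc M)) $ m = ?g M $ m"
      proof (cases "m < 2 \<or> odd m")
        case False
        then have "m = 2 * (m div 2 - 1) + 2" by presburger
        then obtain j where "m = 2 * j + 2" by blast
        then show ?thesis by (simp add: diff)
      qed (auto simp: diff less_2_cases_iff)
    qed
    then show ?case
      using Suc.IH by (simp only: power_Suc2[of _ "Suc M"] mult.assoc)
  qed
qed

text \<open>Vandermonde's identity for the upper indices a and -(a+b+1), whose sum is -(b+1). Upper
  negation, the fact \<open>neg\<close>, turns the negative indices into ordinary binomials.\<close>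

lemma sum_alternating_binomial_Vandermonde:
  "(\<Sum>l\<le>N. (- 1) ^ l * of_nat (a choose l) * of_nat ((a + b + N - l) choose (N - l))) =
     (of_nat ((b + N) choose N) :: 'a::field_char_0)"
proof -
  have neg: "(- of_nat (c + 1) :: 'a) gchoose k = (- 1) ^ k * of_nat ((c + k) choose k)" for c k
  proof -
    have "of_nat (c + 1) + of_nat k - 1 = (of_nat (c + k) :: 'a)" by simp
    then show ?thesis by (simp only: gbinomial_minus binomial_gbinomial)
  qed
  have "(- 1) ^ N * (of_nat ((b + N) choose N) :: 'a) = (of_nat a + - of_nat (a + b + 1)) gchoose N"
    using neg[of b N] by (simp add: algebra_simps)
  also have "\<dots> = (\<Sum>l\<le>N. (of_nat a gchoose l) * (- of_nat (a + b + 1) gchoose (N - l)))"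
    by (simp only: gbinomial_Vandermonde[symmetric] atMost_atLeast0)
  also have "\<dots> = (- 1) ^ N *
      (\<Sum>l\<le>N. (- 1) ^ l * of_nat (a choose l) * of_nat ((a + b + N - l) choose (N - l)))"
    unfolding sum_distrib_left
  proof (rule sum.cong)
    fix l assume l: "l \<in> {..N}"
    then have "(- 1 :: 'a) ^ N = (- 1) ^ (N - l) * (- 1) ^ l"
      by (simp flip: power_add)
    moreover have "(- 1 :: 'a) ^ l * (- 1) ^ l = 1" by (simp flip: power_add)
    moreover have "a + b + (N - l) = a + b + N - l" using l by simp
    ultimately show "(of_nat a gchoose l) * (- of_nat (a + b + 1) gchoose (N - l)) = (- 1) ^ N *
        ((- 1) ^ l * of_nat (a choose l) * of_nat ((a + b + N - l) choose (N - l)) :: 'a)"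
      unfolding neg by (simp add: binomial_gbinomial[symmetric])
  qed simp
  finally show ?thesis by simp
qed

text \<open>Both sides are the trinomial coefficient (N+a)!/(N! l! (a-l)!), or zero when l > a. It
  lets a factor independent of \<open>l\<close> be pulled out of the sum below.\<close>

lemma binomial_trinomial_revision:
  "((N + l) choose l) * ((N + a) choose (N + l)) = ((N + a) choose a) * (a choose l)"
proof (cases "l \<le> a")
  case True
  then have "of_nat (((N + l) choose l) * ((N + a) choose (N + l))) =
      (of_nat (((N + a) choose a) * (a choose l)) :: rat)"
    by (simp add: binomial_fact field_simps)
  then show ?thesis by (simp only: of_nat_eq_iff)
qed (simp add: not_le binomial_eq_0)

text \<open>This is the series G_c, with n = N + 1. For m = 2a + c, trinomial revision makes every
  summand's m-th coefficient a multiple of (N+a choose N), and the alternating sum that remains is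
  evaluated by \<open>sum_alternating_binomial_Vandermonde\<close> with b = a + c.\<close>

lemma diagonal_generating_function:
  "(\<Sum>k = 1..Suc N. fps_const ((- 1) ^ (Suc N - k) / fact (k - 1) *
      (pochhammer (of_nat (Suc N)) (Suc N - k) / fact (Suc N - k))) *
      (fps_deriv ^^ (k - 1)) (fps_X ^ (c + (2 * Suc N - k - 1)) / (1 - fps_X ^ 2) ^ (2 * Suc N - k))) =
    (Abs_fps (\<lambda>m. if c \<le> m \<and> even (m - c)
      then of_nat (((N + (m - c) div 2) choose N) * ((N + (m + c) div 2) choose N)) else 0)
      :: 'a::field_char_0 fps)" (is "?lhs = Abs_fps ?g")
proof (rule fps_ext)
  fix m
  \<comment> \<open>The summand in terms of l = n - k, so that k - 1 = N - l and 2n - k = N + l +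
    1.\<close>
  define t :: "nat \<Rightarrow> 'a fps" where "t l = fps_const ((- 1) ^ l / fact (N - l) * (pochhammer (of_nat (Suc N)) l / fact l)) *
      (fps_deriv ^^ (N - l)) (inverse ((1 - fps_X ^ 2) ^ Suc (N + l)) * fps_X ^ (c + N + l))" for l
  have lhs: "?lhs = (\<Sum>l\<le>N. t l)"
  proof (rule sum.reindex_bij_witness[of _ "\<lambda>l. Suc N - l" "\<lambda>k. Suc N - k"])
    fix k assume k: "k \<in> {1..Suc N}"
    then have e: "k - 1 = N - (Suc N - k)" "2 * Suc N - k = Suc (N + (Suc N - k))"
        "c + (2 * Suc N - k - 1) = c + N + (Suc N - k)" by auto
    have div: "fps_X ^ p / (1 - fps_X ^ 2) ^ q = inverse ((1 - fps_X ^ 2) ^ q) * (fps_X ^ p :: 'a fps)" for p q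
      by (subst fps_divide_unit) (simp_all add: mult.commute)
    show "t (Suc N - k) = fps_const ((- 1) ^ (Suc N - k) / fact (k - 1) *
      (pochhammer (of_nat (Suc N)) (Suc N - k) / fact (Suc N - k))) *
      (fps_deriv ^^ (k - 1)) (fps_X ^ (c + (2 * Suc N - k - 1)) / (1 - fps_X ^ 2) ^ (2 * Suc N - k))"
      unfolding t_def div e by (simp add: add.assoc)
  qed auto
  have t_nth: "t l $ m = (if c \<le> m \<and> even (m - c)
      then of_nat ((N + (m - c) div 2) choose N) * ((- 1) ^ l * of_nat (((m - c) div 2) choose l) *
        of_nat ((m + N - l) choose (N - l))) else 0)" if l: "l \<le> N" for l
  proof -
    define P where "P \<longleftrightarrow> c \<le> m \<and> even (m - c)"
    have poch: "pochhammer (of_nat (Suc N)) l / fact l = (of_nat ((N + l) choose l) :: 'a)"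
      by (simp add: binomial_gbinomial gbinomial_pochhammer' add.commute)
    have "t l $ m = (- 1) ^ l * of_nat ((N + l) choose l) * of_nat ((m + N - l) choose (N - l)) *
        (inverse ((1 - fps_X ^ 2) ^ Suc (N + l)) * fps_X ^ (c + N + l)) $ (m + N - l)"
      unfolding t_def poch using l by (simp add: fps_deriv_pow_nth)
    also have "(inverse ((1 - fps_X ^ 2) ^ Suc (N + l)) * fps_X ^ (c + N + l)) $ (m + N - l) =
        (if c \<le> m \<and> even (m - c) then of_nat ((N + (m - c) div 2) choose (N + l)) else 0 :: 'a)"
    \<comment> \<open>If the inequality fails, the power of X exceeds the index and the left side is
      0. On the right, (m - c) div 2 < l makes the binomial vanish too whenever c is at most
      m.\<close>
    proof (cases "c + 2 * l \<le> m")
      case True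
      then have e: "m + N - l - (c + N + l) = m - c - 2 * l" "\<not> m + N - l < c + N + l" using l by auto
      have "even (m - c - 2 * l) \<longleftrightarrow> even (m - c)" "(m - c - 2 * l) div 2 = (m - c) div 2 - l"
        "l \<le> (m - c) div 2"
        using True by auto
      then show ?thesis
        using True l e(2) unfolding inverse_one_minus_fps_X_squared_power fps_X_power_mult_right_nth e(1) by simp
    next
      case False
      then have "m + N - l < c + N + l" "c \<le> m \<Longrightarrow> (m - c) div 2 < l" using l by auto
      then show ?thesis
        unfolding fps_X_power_mult_right_nth by simp
    qed
    finally have t: "t l $ m = (- 1) ^ l * of_nat ((N + l) choose l) * of_nat ((m + N - l) choose (N - l)) *
        (if P then of_nat ((N + (m - c) div 2) choose (N + l)) else 0)"
      by (simp only: P_def)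
    have "(of_nat ((N + l) choose l) * of_nat ((N + (m - c) div 2) choose (N + l)) :: 'a) =
        of_nat ((N + (m - c) div 2) choose N) * of_nat (((m - c) div 2) choose l)"
      unfolding of_nat_mult[symmetric] binomial_trinomial_revision
      using binomial_symmetric[of N "N + (m - c) div 2"] by simp
    then show ?thesis
      unfolding t P_def[symmetric] by (cases P) (simp_all add: algebra_simps)
  qed
  show "?lhs $ m = Abs_fps ?g $ m"
  proof (cases "c \<le> m \<and> even (m - c)")
    case True
    define a where "a = (m - c) div 2"
    have m: "m = a + (a + c)" using True unfolding a_def by presburger
    have "?lhs $ m = (\<Sum>l\<le>N. of_nat ((N + a) choose N) * ((- 1) ^ l * of_nat (a choose l) *
        of_nat ((m + N - l) choose (N - l))))"
      unfolding lhs fps_sum_nth using True by (intro sum.cong refl) (simp only: t_nth atMost_iff True if_True a_def simp_thms)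
    also have "\<dots> = of_nat ((N + a) choose N) * of_nat ((a + c + N) choose N)"
      unfolding sum_distrib_left[symmetric] m sum_alternating_binomial_Vandermonde ..
    also have "(a + c + N) = N + (m + c) div 2" by (simp add: m)
    finally show ?thesis
      by (simp only: a_def fps_nth_Abs_fps of_nat_mult True if_True simp_thms)
  next
    case False
    have "(\<Sum>l\<le>N. t l $ m) = 0"
      by (intro sum.neutral ballI) (simp only: t_nth atMost_iff False if_False)
    then show ?thesis
      by (simp only: lhs fps_sum_nth fps_nth_Abs_fps False if_False)
  qed
qed

section \<open>From monomial counts to the Poincare series\<close>

lemma card_wmonoms:
  "card (wmonoms (Suc K) N {int c}) =
     (if c \<le> N \<and> even (N - c)
      then ((K + (N - c) div 2) choose K) * ((K + (N + c) div 2) choose K) else 0)"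
  using card_weight[of K N c] by (simp only: wmonoms_def singleton_iff)

lemma PI_nth:
  "PI TYPE('k::field_char_0) (replicate n 1) $ N =
     of_nat (card (wmonoms n N {0})) - of_nat (card (wmonoms n N {2}))"
  using dim_kernel_Dop[of "{0}" n N, where 'k = 'k] invariants_homogeneous[of n N, where 'k = 'k]
  by (simp add: PI_def of_nat_add[symmetric] eq_diff_eq del: of_nat_add)

text \<open>The shift by 2 takes the weights \<open>{0..}\<close> to \<open>{2..}\<close>, so in the
  difference of counts only weights 0 and 1 survive.\<close>

lemma PS_nth:
  "PS TYPE('k::field_char_0) (replicate n 1) $ N =
     of_nat (card (wmonoms n N {0})) + of_nat (card (wmonoms n N {1}))"
proof -
  have "wmonoms n N {0..} = wmonoms n N {2..} \<union> (wmonoms n N {0} \<union> wmonoms n N {1})"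
    by (auto simp: wmonoms_def)
  then have "card (wmonoms n N {0..}) = card (wmonoms n N {2..}) + card (wmonoms n N {0} \<union> wmonoms n N {1})"
    by (simp only:) (rule card_Un_disjoint, auto simp: finite_wmonoms, auto simp: wmonoms_def)
  also have "card (wmonoms n N {0} \<union> wmonoms n N {1}) = card (wmonoms n N {0}) + card (wmonoms n N {1})"
    by (rule card_Un_disjoint) (auto simp: finite_wmonoms, auto simp: wmonoms_def)
  finally have "mpoly.dim {p \<in> supported (wmonoms n N {0..}). Dop p = (0 :: 'k mpoly)} =
      card (wmonoms n N {0}) + card (wmonoms n N {1})"
    using dim_kernel_Dop[of "{0..}" n N, where 'k = 'k] by (simp add: image_add_atLeast)
  then show ?thesis
    by (simp only: PS_def fps_nth_Abs_fps semi_invariants_homogeneous of_nat_add)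
qed

lemma fps_deriv_pow_add: "(fps_deriv ^^ k) (f + g) = (fps_deriv ^^ k) f + (fps_deriv ^^ k) g"
  by (induction k) auto

lemma fps_deriv_pow_diff: "(fps_deriv ^^ k) (f - g :: 'a::comm_ring_1 fps) = (fps_deriv ^^ k) f - (fps_deriv ^^ k) g"
  by (induction k) auto

theorem theorem4p1:
  fixes n :: nat
  assumes "n \<ge> 1"
  shows "PI TYPE('k::field_char_0) (replicate n 1) =
      (\<Sum>k = 1..n.
        fps_const ((-1) ^ (n - k) / fact (k - 1) * (pochhammer (of_nat n) (n - k) / fact (n - k))) *
        (fps_deriv ^^ (k - 1)) ((fps_X / (1 - fps_X ^ 2)) ^ (2 * n - k - 1)))
    \<and> PS TYPE('k) (replicate n 1) =
      (\<Sum>k = 1..n.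
        fps_const ((-1) ^ (n - k) / fact (k - 1) * (pochhammer (of_nat n) (n - k) / fact (n - k))) *
        (fps_deriv ^^ (k - 1))
          ((1 + fps_X) * fps_X ^ (2 * n - k - 1) / (1 - fps_X ^ 2) ^ (2 * n - k)))"
proof -
  obtain K where n: "n = Suc K" using assms by (cases n) auto
  define coef :: "nat \<Rightarrow> rat" where
    "coef k = (-1) ^ (n - k) / fact (k - 1) * (pochhammer (of_nat n) (n - k) / fact (n - k))" for k
  \<comment> \<open>One family covers both formulas: the shift \<open>c\<close> in the numerator is
    the weight being counted.\<close>
  define f :: "nat \<Rightarrow> nat \<Rightarrow> rat fps" where
    "f c k = fps_X ^ (c + (2 * n - k - 1)) / (1 - fps_X ^ 2) ^ (2 * n - k)" for c k
  define G where "G c = (\<Sum>k = 1..n. fps_const (coef k) * (fps_deriv ^^ (k - 1)) (f c k))" for c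
  have G: "G c $ N = of_nat (card (wmonoms n N {int c}))" for c N
    unfolding G_def coef_def f_def n diagonal_generating_function card_wmonoms
    by (simp only: fps_nth_Abs_fps if_distrib[of of_nat] of_nat_0)
  have div: "a / (1 - fps_X ^ 2) ^ q = a * inverse ((1 - fps_X ^ 2) ^ q)" for a :: "rat fps" and q
    by (subst fps_divide_unit) simp_all
  have PI: "(fps_X / (1 - fps_X ^ 2)) ^ (2 * n - k - 1) = f 0 k - f 2 k" if "k \<in> {1..n}" for k
  proof -
    define p where "p = 2 * n - k - 1"
    \<comment> \<open>As k is at most n, \<open>2 * n - k\<close> is positive and the truncated
      subtraction in \<open>p\<close> is exact. Subtracting \<open>f 2 k\<close> then contributes a
      factor \<open>1 - fps_X ^ 2\<close>, which lowers the denominator's exponent from p + 1 to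
      p.\<close>
    have p: "2 * n - k = Suc p" using that by (auto simp: p_def)
    have "f 0 k - f 2 k = fps_X ^ p * ((1 - fps_X ^ 2) * inverse ((1 - fps_X ^ 2) ^ Suc p))"
      unfolding f_def p div by (simp add: algebra_simps power_add power2_eq_square)
    also have "(1 - fps_X ^ 2) * inverse ((1 - fps_X ^ 2) ^ Suc p) = inverse (1 - fps_X ^ 2 :: rat fps) ^ p"
      by (simp add: fps_inverse_mult fps_inverse_power inverse_mult_eq_1' mult.assoc[symmetric])
    finally show ?thesis
      using div[of fps_X 1] by (simp add: p_def power_mult_distrib)
  qed
  have PS: "(1 + fps_X) * fps_X ^ (2 * n - k - 1) / (1 - fps_X ^ 2) ^ (2 * n - k) = f 0 k + f 1 k" for k
    unfolding f_def div by (simp add: algebra_simps)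
  have "PI TYPE('k) (replicate n 1) = G 0 - G 2"
    by (rule fps_ext) (simp only: PI_nth fps_sub_nth G of_nat_0 of_nat_numeral)
  also have "\<dots> = (\<Sum>k = 1..n. fps_const (coef k) *
      (fps_deriv ^^ (k - 1)) ((fps_X / (1 - fps_X ^ 2)) ^ (2 * n - k - 1)))"
    unfolding G_def sum_subtractf[symmetric] right_diff_distrib[symmetric] fps_deriv_pow_diff[symmetric]
    by (intro sum.cong refl) (simp only: PI)
  finally have 1: "PI TYPE('k) (replicate n 1) = \<dots>" .
  have "PS TYPE('k) (replicate n 1) = G 0 + G 1"
    by (rule fps_ext) (simp only: PS_nth fps_add_nth G of_nat_0 of_nat_1)
  also have "\<dots> = (\<Sum>k = 1..n. fps_const (coef k) *
      (fps_deriv ^^ (k - 1)) ((1 + fps_X) * fps_X ^ (2 * n - k - 1) / (1 - fps_X ^ 2) ^ (2 * n - k)))"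
    unfolding G_def sum.distrib[symmetric] distrib_left[symmetric] fps_deriv_pow_add[symmetric] PS ..
  finally show ?thesis using 1 unfolding coef_def by blast
qed

end
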